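(* The sampling modes $(O,R)$ and $(\overline{O},R)$ are equivalent, i.e., for every concept-class triple $(C,Z,\models)$ and every MAP-learner $L$ for it, $$\mathrm{MAP\text{-}TD}^{O,R}_L(C)=\mathrm{MAP\text{-}TD}^{\overline{O},R}_L(C).$$
   Context: A concept-class triple $(C,Z,\models)$ consists of a finite set $C$ with $|C|\ge 2$ (the concept class), a non-empty finite set $Z$ (the observations) and a relation $\models$ on $C\times Z$ (consistency). $\mathcal{Z}^{O,R}$ is the set of finite sequences over $Z$ and $\mathcal{Z}^{\overline{O},R}$ the set of finite multisets over $Z$ (both including the empty one, denoted $\emptyset$); $|I|$ is the length of a sequence or the cardinality with multiplicity of a multiset. For a probability vector $Q=(q(z))_{z\in Z}$: $P^{O,R}((z_1,\dots,z_n)|Q)=\prod_{i=1}^n q(z_i)$; for a multiset $A$ of size $n$ with distinct elements $z'_1,\dots,z'_k$ of multiplicities $n_1,\dots,n_k$, $P^{\overline{O},R}(A|Q)=\frac{n!}{n_1!\cdots n_k!}\prod_{i=1}^k q(z'_i)^{n_i}$. The probability of $\emptyset$ is $1$. A MAP-learner $L$ for $(C,Z,\models)$ is given by priors $P(c)>0$ with $\sum_{c\in C}P(c)=1$ and conditional likelihoods $P(z|c)\ge 0$ with $\sum_{z\in Z}P(z|c)=1$ for each $c\in C$, subject to: $c\not\models z$ implies $P(z|c)=0$. Write $P^{\alpha,R}(I|c)$ for $P^{\alpha,R}(I|P(\cdot|c))$, $\alpha\in\{O,\overline{O}\}$. A teacher for $L$ in mode $(\alpha,R)$ is a map $T:C\to\mathcal{Z}^{\alpha,R}$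 such that for every $c_0\in C$, $c_0$ is the unique maximizer over $c\in C$ of $P(c)\cdot P^{\alpha,R}(T(c_0)|c)$. The order of $T$ is $\max_{c\in C}|T(c)|$. $\mathrm{MAP\text{-}TD}^{\alpha,R}_L(C)$ is the smallest order of a teacher for $L$ in mode $(\alpha,R)$, or $\infty$ if no teacher exists. *)

theory Defs
  imports Complex_Main "HOL-Library.Multiset" "HOL-Library.Extended_Nat"
begin

text \<open>Concept-class triples; \<open>(c, z) \<in> M\<close> means that \<open>c\<close> is consistent with \<open>z\<close>.\<close>

locale concept_class_triple =
  fixes C :: "'c set" and Z :: "'z set" and M :: "('c \<times> 'z) set"
  assumes finite_concepts: "finite C"
    and card_concepts: "card C \<ge> 2"
    and finite_observations: "finite Z"
    and nonempty_observations: "Z \<noteq> {}"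
    and consistency_relation: "M \<subseteq> C \<times> Z"

text \<open>MAP-learners, given by the priors \<open>p c = P(c)\<close> and the likelihoods \<open>l c z = P(z | c)\<close>.
  Values outside \<open>C\<close> and \<open>Z\<close> are junk, and nothing below depends on them.\<close>

locale MAP_learner = concept_class_triple C Z M
  for C :: "'c set" and Z :: "'z set" and M :: "('c \<times> 'z) set" +
  fixes p :: "'c \<Rightarrow> real" and l :: "'c \<Rightarrow> 'z \<Rightarrow> real"
  assumes prior_pos: "c \<in> C \<Longrightarrow> p c > 0"
    and prior_sum: "(\<Sum>c\<in>C. p c) = 1"
    and likelihood_nonneg: "c \<in> C \<Longrightarrow> z \<in> Z \<Longrightarrow> l c z \<ge> 0"
    and likelihood_sum: "c \<in> C \<Longrightarrow> (\<Sum>z\<in>Z. l c z) = 1"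
    and likelihood_inconsistent: "c \<in> C \<Longrightarrow> z \<in> Z \<Longrightarrow> (c, z) \<notin> M \<Longrightarrow> l c z = 0"

text \<open>A sampling mode provides the admissible inputs over an observation set, the size of an
  input, and the probability of an input under a probability vector on the observations.\<close>

record ('z, 'i) sampling_mode =
  inputs :: "'z set \<Rightarrow> 'i set"
  input_size :: "'i \<Rightarrow> nat"
  input_prob :: "('z \<Rightarrow> real) \<Rightarrow> 'i \<Rightarrow> real"

text \<open>The mode \<open>(O, R)\<close>: ordered sampling with replacement.\<close>

definition ordered_mode :: "('z, 'z list) sampling_mode" where
  "ordered_mode =
    \<lparr>inputs = lists,
     input_size = length,
     input_prob = (\<lambda>q I. \<Prod>i<length I. q (I ! i))\<rparr>"

text \<open>The mode with unordered sampling with replacement: the probability of a multiset is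
  multinomial.\<close>

definition unordered_mode :: "('z, 'z multiset) sampling_mode" where
  "unordered_mode =
    \<lparr>inputs = (\<lambda>Z. {A. set_mset A \<subseteq> Z}),
     input_size = size,
     input_prob = (\<lambda>q A. fact (size A) / (\<Prod>z\<in>set_mset A. fact (count A z))
                          * (\<Prod>z\<in>set_mset A. q z ^ count A z))\<rparr>"

definition is_teacher ::
  "('z, 'i) sampling_mode \<Rightarrow> 'c set \<Rightarrow> 'z set \<Rightarrow> ('c \<Rightarrow> real) \<Rightarrow> ('c \<Rightarrow> 'z \<Rightarrow> real) \<Rightarrow> ('c \<Rightarrow> 'i) \<Rightarrow> bool"
where
  "is_teacher m C Z p l T \<longleftrightarrow>
    (\<forall>c0\<in>C. T c0 \<in> inputs m Z \<and>
      {c. is_arg_max (\<lambda>c. p c * input_prob m (l c) (T c0)) (\<lambda>c. c \<in> C) c} = {c0})"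

definition teacher_order :: "('z, 'i) sampling_mode \<Rightarrow> 'c set \<Rightarrow> ('c \<Rightarrow> 'i) \<Rightarrow> nat" where
  "teacher_order m C T = Max ((\<lambda>c. input_size m (T c)) ` C)"

text \<open>The infimum in \<^typ>\<open>enat\<close> is attained if a teacher exists, and is \<open>\<infinity>\<close> otherwise.\<close>

definition MAP_TD ::
  "('z, 'i) sampling_mode \<Rightarrow> 'c set \<Rightarrow> 'z set \<Rightarrow> ('c \<Rightarrow> real) \<Rightarrow> ('c \<Rightarrow> 'z \<Rightarrow> real) \<Rightarrow> enat"
where
  "MAP_TD m C Z p l = Inf {enat (teacher_order m C T) |T. is_teacher m C Z p l T}"

end

theory Submission
  imports Defs
begin

text \<open>All orderings of a multiset \<open>A\<close> have the same probability under \<open>q\<close>, and the multinomial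
  probability of \<open>A\<close> is that common value times the multinomial coefficient, which does not depend
  on \<open>q\<close>. So the two posteriors differ by a positive factor independent of the concept.\<close>

lemma input_prob_unordered_mset:
  "input_prob unordered_mode q (mset I) =
    fact (length I) / (\<Prod>z\<in>set I. fact (count (mset I) z)) * input_prob ordered_mode q I"
proof -
  have "(\<Prod>i<length I. q (I ! i)) = prod_list (map q I)"
    by (simp add: prod.list_conv_set_nth atLeast0LessThan)
  \<comment> \<open>Passing to the product over the multiset forgets the positions, so that equal
    factors can be collected into powers.\<close>
  also have "\<dots> = prod_mset (image_mset q (mset I))"
    by (simp flip: prod_mset_prod_list)
  also have "\<dots> = (\<Prod>z\<in>set I. q z ^ count (mset I) z)"
    by (simp add: image_prod_mset_multiplicity)
  finally show ?thesis
    by (simp add: ordered_mode_def unordered_mode_def)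
qed

lemma is_arg_max_cmult:
  fixes f :: "'a \<Rightarrow> real"
  assumes "k > 0"
  shows "is_arg_max (\<lambda>x. k * f x) P = is_arg_max f P"
  using assms by (simp add: is_arg_max_def fun_eq_iff)

text \<open>The teacher condition is checked input by input, and forgetting the order preserves both
  admissibility and the set of maximizers. The equivalence carries teachers in both
  directions.\<close>

lemma is_teacher_mset_iff:
  "is_teacher unordered_mode C Z p l (mset \<circ> T) \<longleftrightarrow> is_teacher ordered_mode C Z p l T"
proof -
  have "is_arg_max (\<lambda>c. p c * input_prob unordered_mode (l c) (mset I)) P =
        is_arg_max (\<lambda>c. p c * input_prob ordered_mode (l c) I) P" for I P
  proof -
    have "fact (length I) / (\<Prod>z\<in>set I. fact (count (mset I) z)) > (0 :: real)"
      by (simp add: prod_pos)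
    from is_arg_max_cmult[OF this, of "\<lambda>c. p c * input_prob ordered_mode (l c) I" P]
    show ?thesis
      by (simp add: input_prob_unordered_mset mult.left_commute)
  qed
  moreover have "mset I \<in> inputs unordered_mode Z \<longleftrightarrow> I \<in> inputs ordered_mode Z" for I
    by (auto simp: ordered_mode_def unordered_mode_def)
  ultimately show ?thesis
    by (simp add: is_teacher_def)
qed

lemma teacher_order_mset:
  "teacher_order unordered_mode C (mset \<circ> T) = teacher_order ordered_mode C T"
  by (simp add: teacher_order_def ordered_mode_def unordered_mode_def)

theorem mainTheorem5:
  fixes C :: "'c set" and Z :: "'z set" and M :: "('c \<times> 'z) set"
    and p :: "'c \<Rightarrow> real" and l :: "'c \<Rightarrow> 'z \<Rightarrow> real"
  assumes "MAP_learner C Z M p l"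
  shows "MAP_TD ordered_mode C Z p l = MAP_TD unordered_mode C Z p l"
proof -
  \<comment> \<open>Choosing an ordering of each multiset \<open>T c\<close> makes \<open>T'\<close>
    a preimage of \<open>T\<close>. Hence both modes attain the same set of orders, which also
    covers the case without teachers, where both infima are \<infinity>.\<close>
  have "\<exists>T'. T = mset \<circ> T'" for T :: "'c \<Rightarrow> 'z multiset"
    using ex_mset by (metis comp_apply ext)
  then have "{enat (teacher_order ordered_mode C T) |T. is_teacher ordered_mode C Z p l T} =
      {enat (teacher_order unordered_mode C T) |T. is_teacher unordered_mode C Z p l T}"
    by (metis is_teacher_mset_iff teacher_order_mset)
  then show ?thesis
    by (simp add: MAP_TD_def)
qed

end
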